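(* Let $(s_0,b_0,b_1,s_1)\in\Theta$ and $\kappa\in\mathcal K$, and let $\Upsilon:L^1\to L^1$ be the corresponding RealLife Euclidean automaton (extended to $L^1=L^1(\mathbb R^D,\lambda)$). Then $\Upsilon$ is $L^1$-continuous on ${}^0\!\mathcal A^{\mathbb R^D}$; that is, $\Upsilon$ is continuous, with respect to the norm $\|\cdot\|_1$, at every point of ${}^0\!\mathcal A^{\mathbb R^D}$.
   Context: Let $D\ge 1$, let $\lambda$ be Lebesgue measure on $\mathbb R^D$, and $L^1=L^1(\mathbb R^D,\lambda)$. Let $\mathcal A=\{0,1\}$; $\mathcal A^{\mathbb R^D}$ denotes the set of Borel-measurable functions $\mathbf a:\mathbb R^D\to\{0,1\}$, and ${}^1\!\mathcal A^{\mathbb R^D}=\mathcal A^{\mathbb R^D}\cap L^1$. $\mathcal K$ is the set of $\kappa\in L^\infty(\mathbb R^D;[0,\infty))$ with compact support and $\int\kappa\,d\lambda=1$. Convolution: $(\kappa*\mathbf a)(x)=\int_{\mathbb R^D}\kappa(y)\mathbf a(x-y)\,d\lambda(y)$. $\Theta=\{(s_0,b_0,b_1,s_1): 0<s_0\le b_0<b_1\le s_1\le 1\}$. Given $\kappa\in\mathcal K$ and $(s_0,b_0,b_1,s_1)\in\Theta$, put $\mathfrak s=\mathbf 1_{[s_0,s_1]}$ and $\mathfrak b=\mathbf 1_{[b_0,b_1]}$. The RealLife Euclidean automaton is $$\Upsilon(\mathbf a)(x)=\mathbf a(x)\,\mathfrak s(\kappa*\mathbf a(x))+(1-\mathbf a(x))\,\mathfrak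 b(\kappa*\mathbf a(x)).$$ It maps $\mathcal A^{\mathbb R^D}$ to itself, and the same formula defines a map $\Upsilon:L^1\to L^1$. For $\mathbf a\in{}^1\!\mathcal A^{\mathbb R^D}$ let $M(\mathbf a)=\lambda\{x:\kappa*\mathbf a(x)\in\{s_0,b_0,b_1,s_1\}\}$, and ${}^0\!\mathcal A^{\mathbb R^D}=\{\mathbf a\in{}^1\!\mathcal A^{\mathbb R^D}: M(\mathbf a)=0\}$ (this depends on $\kappa$ and on the thresholds). *)

theory Defs
  imports "HOL-Analysis.Analysis"
begin

text \<open>
  Elements of \<open>L\<^sup>1\<close> and \<open>L\<^sup>\<infinity>\<close> are represented by Borel measurable functions rather than by
  classes modulo equality almost everywhere.  Thus \<open>L1_norm\<close> is a seminorm on \<open>L1\<close>.  The lemmas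
  at the end show that the automaton maps \<open>L1\<close> to itself and respects equality almost everywhere,
  so that it induces a map on classes.
\<close>

definition L1 :: "('a::euclidean_space \<Rightarrow> real) set"
  where "L1 = {f. integrable lborel f}"

definition L1_norm :: "('a::euclidean_space \<Rightarrow> real) \<Rightarrow> real"
  where "L1_norm f = (\<integral>x. \<bar>f x\<bar> \<partial>lborel)"

text \<open>The competitors \<open>f\<close> range over all of \<open>L1\<close>: this is continuity of \<open>F\<close> at the
  point \<open>g\<close>, not of a restriction of \<open>F\<close> to a subset.\<close>

definition L1_continuous_at ::
  "(('a::euclidean_space \<Rightarrow> real) \<Rightarrow> ('a \<Rightarrow> real)) \<Rightarrow> ('a \<Rightarrow> real) \<Rightarrow> bool"
  where "L1_continuous_at F g \<longleftrightarrow>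
    (\<forall>\<epsilon>>0. \<exists>\<delta>>0. \<forall>f\<in>L1. L1_norm (\<lambda>x. f x - g x) < \<delta> \<longrightarrow> L1_norm (\<lambda>x. F f x - F g x) < \<epsilon>)"

text \<open>The support of a class: the complement of the largest open set on which it vanishes almost
  everywhere.\<close>

definition ess_support :: "('a::euclidean_space \<Rightarrow> real) \<Rightarrow> 'a set"
  where "ess_support f = - \<Union>{U. open U \<and> (AE x in lborel. x \<in> U \<longrightarrow> f x = 0)}"

definition kernels :: "('a::euclidean_space \<Rightarrow> real) set"
  where "kernels = {\<kappa>. \<kappa> \<in> borel_measurable borel \<and>
    (AE x in lborel. 0 \<le> \<kappa> x) \<and> (\<exists>C. AE x in lborel. \<bar>\<kappa> x\<bar> \<le> C) \<and>
    compact (ess_support \<kappa>) \<and> (\<integral>x. \<kappa> x \<partial>lborel) = 1}"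

definition convolution :: "('a::euclidean_space \<Rightarrow> real) \<Rightarrow> ('a \<Rightarrow> real) \<Rightarrow> 'a \<Rightarrow> real"
  where "convolution \<kappa> f x = (\<integral>y. \<kappa> y * f (x - y) \<partial>lborel)"

definition Theta :: "(real \<times> real \<times> real \<times> real) set"
  where "Theta = {(s0, b0, b1, s1). 0 < s0 \<and> s0 \<le> b0 \<and> b0 < b1 \<and> b1 \<le> s1 \<and> s1 \<le> 1}"

fun RealLife ::
  "('a::euclidean_space \<Rightarrow> real) \<Rightarrow> real \<times> real \<times> real \<times> real \<Rightarrow> ('a \<Rightarrow> real) \<Rightarrow> 'a \<Rightarrow> real"
  where "RealLife \<kappa> (s0, b0, b1, s1) f x =
    f x * indicator {s0..s1} (convolution \<kappa> f x) +
    (1 - f x) * indicator {b0..b1} (convolution \<kappa> f x)"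

definition configs :: "('a::euclidean_space \<Rightarrow> real) set"
  where "configs = {a \<in> borel_measurable borel. \<forall>x. a x \<in> {0, 1}}"

definition configs1 :: "('a::euclidean_space \<Rightarrow> real) set"
  where "configs1 = configs \<inter> L1"

fun threshold_mass ::
  "('a::euclidean_space \<Rightarrow> real) \<Rightarrow> real \<times> real \<times> real \<times> real \<Rightarrow> ('a \<Rightarrow> real) \<Rightarrow> ennreal"
  where "threshold_mass \<kappa> (s0, b0, b1, s1) a =
    emeasure lborel {x. convolution \<kappa> a x \<in> {s0, b0, b1, s1}}"

definition configs0 ::
  "('a::euclidean_space \<Rightarrow> real) \<Rightarrow> real \<times> real \<times> real \<times> real \<Rightarrow> ('a \<Rightarrow> real) set"
  where "configs0 \<kappa> \<theta> = {a \<in> configs1. threshold_mass \<kappa> \<theta> a = 0}"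

lemma lborel_reflect_translate:
  fixes x :: "'a::euclidean_space"
  shows "distr lborel lborel (\<lambda>y. x - y) = lborel"
proof -
  have "distr lborel lborel (\<lambda>y. x - y) = distr lborel borel (\<lambda>y. x + (-1) *\<^sub>R y)"
    by (intro distr_cong) auto
  also have "\<dots> = density (distr lborel borel (\<lambda>y. x + (-1) *\<^sub>R y)) (\<lambda>_. \<bar>-1::real\<bar> ^ DIM('a))"
    by (simp add: density_1)
  also have "\<dots> = lborel"
    by (rule lborel_affine[symmetric]) simp
  finally show ?thesis .
qed

lemma kernel_integrable:
  assumes "\<kappa> \<in> kernels"
  shows "integrable lborel \<kappa>"
  using assms not_integrable_integral_eq[of lborel \<kappa>] by (auto simp: kernels_def)

lemma convolution_integrable:
  fixes \<kappa> :: "'a::euclidean_space \<Rightarrow> real"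
  assumes \<kappa>: "\<kappa> \<in> kernels" and f: "f \<in> L1"
  shows "integrable lborel (convolution \<kappa> f)"
proof -
  have [measurable]: "\<kappa> \<in> borel_measurable borel" "f \<in> borel_measurable borel"
    using \<kappa> f by (auto simp: kernels_def L1_def dest: borel_measurable_integrable)
  have translate: "integrable lborel (\<lambda>x. f (x - y))"
      "(\<integral>x. \<bar>f (x - y)\<bar> \<partial>lborel) = (\<integral>x. \<bar>f x\<bar> \<partial>lborel)" for y
  proof -
    have d: "distr lborel borel ((+) (- y)) = lborel"
      by (rule lborel_distr_plus)
    have "integrable (distr lborel borel ((+) (- y))) f"
      using f unfolding d by (simp add: L1_def)
    then show "integrable lborel (\<lambda>x. f (x - y))"
      by (subst (asm) integrable_distr_eq) auto
    have "(\<integral>x. \<bar>f x\<bar> \<partial>lborel) = (\<integral>x. \<bar>f x\<bar> \<partial>distr lborel borel ((+) (- y)))"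
      by (simp only: d)
    also have "\<dots> = (\<integral>x. \<bar>f (x - y)\<bar> \<partial>lborel)"
      by (subst integral_distr) auto
    finally show "(\<integral>x. \<bar>f (x - y)\<bar> \<partial>lborel) = (\<integral>x. \<bar>f x\<bar> \<partial>lborel)" ..
  qed
  have "integrable (lborel \<Otimes>\<^sub>M lborel) (\<lambda>(y, x). \<kappa> y * f (x - y))"
  proof (rule lborel_pair.Fubini_integrable)
    show "(\<lambda>(y, x). \<kappa> y * f (x - y)) \<in> borel_measurable (lborel \<Otimes>\<^sub>M lborel)"
      by measurable
    show "integrable lborel
        (\<lambda>y. \<integral>x. norm (case (y, x) of (y, x) \<Rightarrow> \<kappa> y * f (x - y)) \<partial>lborel)"
      using kernel_integrable[OF \<kappa>] by (simp add: abs_mult translate)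
    show "AE y in lborel. integrable lborel (\<lambda>x. case (y, x) of (y, x) \<Rightarrow> \<kappa> y * f (x - y))"
      using translate by auto
  qed
  from lborel_pair.integrable_product_swap[OF this]
  have "integrable (lborel \<Otimes>\<^sub>M lborel) (\<lambda>(x, y). \<kappa> y * f (x - y))"
    by simp
  from lborel_pair.integrable_fst'[OF this] show ?thesis
    by (simp add: convolution_def[abs_def])
qed

lemma RealLife_in_L1:
  assumes \<kappa>: "\<kappa> \<in> kernels" and \<theta>: "\<theta> \<in> Theta" and f: "f \<in> L1"
  shows "RealLife \<kappa> \<theta> f \<in> L1"
proof -
  obtain s0 b0 b1 s1 where \<theta>_eq: "\<theta> = (s0, b0, b1, s1)" and "0 < b0"
    using \<theta> by (auto simp: Theta_def)
  let ?c = "convolution \<kappa> f"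
  have int: "integrable lborel f" "integrable lborel ?c"
    using f convolution_integrable[OF \<kappa> f] by (auto simp: L1_def)
  then have [measurable]: "f \<in> borel_measurable borel" "?c \<in> borel_measurable borel"
    by (auto dest: borel_measurable_integrable)
  have "integrable lborel (\<lambda>x. f x * indicator {s0..s1} (?c x) +
      (1 - f x) * indicator {b0..b1} (?c x))"
  proof (rule Bochner_Integration.integrable_bound)
    show "integrable lborel (\<lambda>x. 2 * \<bar>f x\<bar> + \<bar>?c x\<bar> / b0)"
      using int by auto
    show "AE x in lborel. norm (f x * indicator {s0..s1} (?c x) +
        (1 - f x) * indicator {b0..b1} (?c x)) \<le> norm (2 * \<bar>f x\<bar> + \<bar>?c x\<bar> / b0)"
    proof (rule AE_I2)
      fix x
      have "1 \<le> \<bar>?c x\<bar> / b0" if "?c x \<in> {b0..b1}"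
        using that \<open>0 < b0\<close> by (auto simp: field_simps)
      moreover have "0 \<le> \<bar>?c x\<bar> / b0"
        using \<open>0 < b0\<close> by simp
      ultimately show "norm (f x * indicator {s0..s1} (?c x) +
          (1 - f x) * indicator {b0..b1} (?c x)) \<le> norm (2 * \<bar>f x\<bar> + \<bar>?c x\<bar> / b0)"
        unfolding indicator_def of_bool_def real_norm_def
        by (cases "?c x \<in> {s0..s1}"; cases "?c x \<in> {b0..b1}") (simp_all, linarith+)
    qed
  qed measurable
  moreover have "RealLife \<kappa> \<theta> f = (\<lambda>x. f x * indicator {s0..s1} (?c x) +
      (1 - f x) * indicator {b0..b1} (?c x))"
    by (rule ext) (simp add: \<theta>_eq)
  ultimately show ?thesis
    by (simp add: L1_def)
qed

lemma RealLife_AE_cong: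
  assumes f: "f \<in> L1" and g: "g \<in> L1" and eq: "AE x in lborel. f x = g x"
    and \<kappa>: "\<kappa> \<in> kernels"
  shows "AE x in lborel. RealLife \<kappa> \<theta> f x = RealLife \<kappa> \<theta> g x"
proof -
  have [measurable]: "f \<in> borel_measurable borel" "g \<in> borel_measurable borel"
      "\<kappa> \<in> borel_measurable borel"
    using f g \<kappa> by (auto simp: L1_def kernels_def dest: borel_measurable_integrable)
  have "convolution \<kappa> f x = convolution \<kappa> g x" for x
    unfolding convolution_def
  proof (rule integral_cong_AE)
    have "AE z in distr lborel lborel (\<lambda>y. x - y). f z = g z"
      using eq by (simp only: lborel_reflect_translate)
    then have "AE y in lborel. f (x - y) = g (x - y)"
      by (subst (asm) AE_distr_iff) auto
    then show "AE y in lborel. \<kappa> y * f (x - y) = \<kappa> y * g (x - y)"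
      by eventually_elim simp
  qed measurable
  then show ?thesis
    using eq by (cases \<theta>) auto
qed

end

theory Submission
  imports Defs
begin

text \<open>
  Since the kernel is essentially bounded, an \<open>L\<^sup>1\<close>-perturbation of \<open>a\<close> perturbs \<open>\<kappa> * a\<close>
  uniformly.  So, apart from an error at most the \<open>L\<^sup>1\<close>-perturbation itself, the output changes only
  where \<open>\<kappa> * a\<close> is within \<open>\<eta>\<close> of a threshold.  The thresholds are positive and \<open>\<kappa> * a\<close> is
  integrable, so this region has finite measure for small \<open>\<eta>\<close>, and as \<open>\<eta>\<close> tends to \<open>0\<close> it shrinks
  to the null set on which \<open>\<kappa> * a\<close> equals a threshold.
\<close>

text \<open>Dominated convergence along a sequence of radii tending to 0: off the null set where
  \<open>f\<close> hits a level, the indicators tend to 0 pointwise. Positivity of the levels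
  supplies the integrable majorant, a multiple of \<open>\<bar>f x\<bar>\<close>.\<close>

lemma measure_near_positive_levels:
  fixes f :: "'a \<Rightarrow> real" and e :: real
  assumes f: "integrable M f" and P: "finite P" "\<And>p. p \<in> P \<Longrightarrow> 0 < p"
    and null: "AE x in M. f x \<notin> P" and e: "0 < e"
  obtains \<eta> where "0 < \<eta>"
    "integrable M (\<lambda>x. of_bool (\<exists>p\<in>P. \<bar>f x - p\<bar> \<le> \<eta>) :: real)"
    "(\<integral>x. of_bool (\<exists>p\<in>P. \<bar>f x - p\<bar> \<le> \<eta>) \<partial>M) < e"
proof -
  \<comment> \<open>Half the smallest level, so that a value within \<open>m\<close> of some level
    is still at least \<open>m\<close>. Inserting 1 keeps \<open>Min\<close> meaningful for empty
    \<open>P\<close>.\<close>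
  obtain m where m: "0 < m" "\<And>p. p \<in> P \<Longrightarrow> 2 * m \<le> p"
  proof (rule that)
    show "0 < Min (insert 1 P) / 2"
      using P by simp
    show "2 * (Min (insert 1 P) / 2) \<le> p" if "p \<in> P" for p
      using that P by simp
  qed
  have [measurable]: "f \<in> borel_measurable M"
    using f by auto
  define r where "r n = m / real (Suc n)" for n
  define h :: "nat \<Rightarrow> 'a \<Rightarrow> real" where "h n x = of_bool (\<exists>p\<in>P. \<bar>f x - p\<bar> \<le> r n)" for n x
  have r: "0 < r n" "r n \<le> m" for n
    using m(1) by (auto simp: r_def field_simps)
  have r_lim: "r \<longlonglongrightarrow> 0"
    unfolding r_def
    using tendsto_mult_right_zero[OF LIMSEQ_inverse_real_of_nat, of m] by (simp add: field_simps)
  have [measurable]: "h n \<in> borel_measurable M" for n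
    unfolding h_def using P(1) by measurable
  have dom: "AE x in M. norm (h n x) \<le> \<bar>f x\<bar> / m" for n
  proof (rule AE_I2)
    fix x
    have "m \<le> \<bar>f x\<bar>" if "p \<in> P" "\<bar>f x - p\<bar> \<le> r n" for p
      using that m(2)[of p] r[of n] by linarith
    then show "norm (h n x) \<le> \<bar>f x\<bar> / m"
      using m(1) by (auto simp: h_def field_simps)
  qed
  have lim: "AE x in M. (\<lambda>n. h n x) \<longlonglongrightarrow> 0"
    using null
  proof eventually_elim
    fix x assume x: "f x \<notin> P"
    \<comment> \<open>As \<open>P\<close> is finite, one index from which all the strict
      inequalities hold can be chosen for all levels together.\<close>
    have "\<forall>\<^sub>F n in sequentially. \<forall>p\<in>P. r n < \<bar>f x - p\<bar>"
      using P(1) x by (auto intro!: eventually_ball_finite order_tendstoD(2)[OF r_lim])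
    then have "\<forall>\<^sub>F n in sequentially. h n x = 0"
      by eventually_elim (auto simp: h_def not_le)
    then show "(\<lambda>n. h n x) \<longlonglongrightarrow> 0"
      by (rule tendsto_eventually)
  qed
  have "(\<lambda>n. integral\<^sup>L M (h n)) \<longlonglongrightarrow> integral\<^sup>L M (\<lambda>_. 0)"
    by (rule integral_dominated_convergence[where w = "\<lambda>x. \<bar>f x\<bar> / m"])
      (use f lim dom in auto)
  then have "\<forall>\<^sub>F n in sequentially. integral\<^sup>L M (h n) < e"
    using e by (simp add: order_tendstoD(2))
  then obtain n where n: "integral\<^sup>L M (h n) < e"
    by (auto simp: eventually_sequentially)
  have "integrable M (h n)"
    by (rule Bochner_Integration.integrable_bound[where f = "\<lambda>x. \<bar>f x\<bar> / m"])
      (use f dom[of n] m(1) in auto)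
  then show thesis
    using that[OF r(1)[of n]] n by (simp add: h_def[abs_def])
qed

text \<open>Young's inequality for a bounded kernel. It holds at every \<open>x\<close>, because the
  exceptional null set of the bound on \<kappa> lies in the integration variable.\<close>

lemma convolution_diff_bound:
  fixes \<kappa> :: "'a::euclidean_space \<Rightarrow> real"
  assumes \<kappa>: "\<kappa> \<in> borel_measurable borel" "AE x in lborel. \<bar>\<kappa> x\<bar> \<le> C"
    and f: "f \<in> L1" and g: "g \<in> L1"
  shows "\<bar>convolution \<kappa> f x - convolution \<kappa> g x\<bar> \<le> C * L1_norm (\<lambda>x. f x - g x)"
proof -
  have [measurable]: "\<kappa> \<in> borel_measurable borel" "f \<in> borel_measurable borel"
      "g \<in> borel_measurable borel"
    using \<kappa> f g by (auto simp: L1_def dest: borel_measurable_integrable)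
  have reflect: "integrable lborel (\<lambda>y. h (x - y))"
      "(\<integral>y. h (x - y) \<partial>lborel) = (\<integral>y. h y \<partial>lborel)" if h: "integrable lborel h" for h :: "'a \<Rightarrow> real"
  proof -
    have [measurable]: "h \<in> borel_measurable borel"
      using h by (auto dest: borel_measurable_integrable)
    have "integrable (distr lborel lborel (\<lambda>y. x - y)) h"
      using h by (simp only: lborel_reflect_translate)
    then show "integrable lborel (\<lambda>y. h (x - y))"
      by (subst (asm) integrable_distr_eq) auto
    have "(\<integral>y. h y \<partial>lborel) = (\<integral>y. h y \<partial>distr lborel lborel (\<lambda>y. x - y))"
      by (simp only: lborel_reflect_translate)
    also have "\<dots> = (\<integral>y. h (x - y) \<partial>lborel)"
      by (subst integral_distr) auto
    finally show "(\<integral>y. h (x - y) \<partial>lborel) = (\<integral>y. h y \<partial>lborel)" ..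
  qed
  \<comment> \<open>Both convolution integrals must exist before their difference can be taken under
    one integral; a non-integrable integrand would give the default value 0.\<close>
  have prod: "integrable lborel (\<lambda>y. \<kappa> y * h (x - y))" if h: "integrable lborel h" for h
  proof (rule Bochner_Integration.integrable_bound)
    have [measurable]: "h \<in> borel_measurable borel"
      using h by (auto dest: borel_measurable_integrable)
    show "integrable lborel (\<lambda>y. C * h (x - y))"
      using reflect(1)[OF h] by simp
    show "(\<lambda>y. \<kappa> y * h (x - y)) \<in> borel_measurable lborel"
      by measurable
    show "AE y in lborel. norm (\<kappa> y * h (x - y)) \<le> norm (C * h (x - y))"
      using \<kappa>(2) by eventually_elim (auto simp: abs_mult intro!: mult_right_mono)
  qed
  have int: "integrable lborel f" "integrable lborel g"
    using f g by (auto simp: L1_def)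
  then have diff: "integrable lborel (\<lambda>x. f x - g x)"
    by simp
  have "convolution \<kappa> f x - convolution \<kappa> g x = (\<integral>y. \<kappa> y * (f (x - y) - g (x - y)) \<partial>lborel)"
    using prod[OF int(1)] prod[OF int(2)] by (simp add: convolution_def right_diff_distrib)
  also have "\<bar>\<dots>\<bar> \<le> (\<integral>y. \<bar>\<kappa> y * (f (x - y) - g (x - y))\<bar> \<partial>lborel)"
    by (rule integral_abs_bound)
  also have "\<dots> \<le> (\<integral>y. C * \<bar>f (x - y) - g (x - y)\<bar> \<partial>lborel)"
  proof (rule integral_mono_AE)
    show "integrable lborel (\<lambda>y. \<bar>\<kappa> y * (f (x - y) - g (x - y))\<bar>)"
      using prod[OF diff] by (rule integrable_abs)
    show "integrable lborel (\<lambda>y. C * \<bar>f (x - y) - g (x - y)\<bar>)"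
      using reflect(1)[OF diff] by auto
    show "AE y in lborel. \<bar>\<kappa> y * (f (x - y) - g (x - y))\<bar> \<le> C * \<bar>f (x - y) - g (x - y)\<bar>"
      using \<kappa>(2) by eventually_elim (auto simp: abs_mult intro!: mult_right_mono)
  qed
  also have "\<dots> = C * L1_norm (\<lambda>x. f x - g x)"
    using reflect(2)[of "\<lambda>y. \<bar>f y - g y\<bar>"] diff by (simp add: L1_norm_def)
  finally show ?thesis .
qed

text \<open>Membership in an interval can change between \<open>c\<close> and \<open>d\<close> only
  if an endpoint is within \<open>\<eta>\<close> of \<open>c\<close>; otherwise both points lie on
  the same side of each endpoint.\<close>

lemma indicator_interval_diff_le:
  fixes c d :: real
  assumes "\<bar>d - c\<bar> \<le> \<eta>" "p \<in> P" "q \<in> P"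
  shows "\<bar>indicator {p..q} d - indicator {p..q} c :: real\<bar> \<le> of_bool (\<exists>r\<in>P. \<bar>c - r\<bar> \<le> \<eta>)"
proof (cases "\<bar>c - p\<bar> \<le> \<eta> \<or> \<bar>c - q\<bar> \<le> \<eta>")
  case True
  then have "\<exists>r\<in>P. \<bar>c - r\<bar> \<le> \<eta>"
    using assms by blast
  then show ?thesis
    by (simp add: indicator_def)
next
  case False
  then have "d \<in> {p..q} \<longleftrightarrow> c \<in> {p..q}"
    using assms(1) by auto
  then show ?thesis
    by (simp add: indicator_def)
qed

text \<open>The change of state and the change of convolution are separated. Only \<open>a\<close>
  has to be two-valued; \<open>f x\<close> may be any real number.\<close>

lemma RealLife_diff_bound:
  assumes a: "a x \<in> {0, 1}"
    and close: "\<bar>convolution \<kappa> f x - convolution \<kappa> a x\<bar> \<le> \<eta>"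
  shows "\<bar>RealLife \<kappa> (s0, b0, b1, s1) f x - RealLife \<kappa> (s0, b0, b1, s1) a x\<bar>
    \<le> \<bar>f x - a x\<bar> + of_bool (\<exists>p\<in>{s0, b0, b1, s1}. \<bar>convolution \<kappa> a x - p\<bar> \<le> \<eta>)"
    (is "\<bar>?F - ?A\<bar> \<le> _ + ?N")
proof -
  let ?c = "convolution \<kappa> a x" and ?d = "convolution \<kappa> f x"
  define S B where "S = (\<lambda>t. indicator {s0..s1} t :: real)" and "B = (\<lambda>t. indicator {b0..b1} t :: real)"
  have SB: "\<bar>S ?d - S ?c\<bar> \<le> ?N" "\<bar>B ?d - B ?c\<bar> \<le> ?N"
    unfolding S_def B_def by (intro indicator_interval_diff_le[OF close]; simp)+
  have "\<bar>S ?d - B ?d\<bar> \<le> 1"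
    by (simp add: S_def B_def indicator_def)
  then have "\<bar>(f x - a x) * (S ?d - B ?d)\<bar> \<le> \<bar>f x - a x\<bar>"
    by (simp add: abs_mult mult_left_le)
  \<comment> \<open>Since \<open>a x\<close> is 0 or 1, exactly one of the two terms survives, so
    the near-threshold indicator is paid for only once.\<close>
  moreover have "\<bar>a x * (S ?d - S ?c) + (1 - a x) * (B ?d - B ?c)\<bar> \<le> ?N"
  proof (cases "a x = 0")
    case True
    show ?thesis
      unfolding True using SB(2) by (simp only: mult_zero_left diff_0_right mult_1_left add_0_left)
  next
    case False
    then have "a x = 1"
      using a by blast
    then show ?thesis
      using SB(1) by (simp only: mult_zero_left diff_self mult_1_left add_0_right)
  qed
  moreover have "?F - ?A = (f x - a x) * (S ?d - B ?d)
      + (a x * (S ?d - S ?c) + (1 - a x) * (B ?d - B ?c))"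
    by (simp add: S_def B_def algebra_simps)
  ultimately show ?thesis
    by linarith
qed

theorem theorem1p1:
  fixes \<kappa> :: "real ^ 'n \<Rightarrow> real" and \<theta> :: "real \<times> real \<times> real \<times> real"
  assumes "\<theta> \<in> Theta" and "\<kappa> \<in> kernels"
  shows "\<forall>a \<in> configs0 \<kappa> \<theta>. L1_continuous_at (RealLife \<kappa> \<theta>) a"
  unfolding L1_continuous_at_def
proof (intro ballI allI impI)
  fix a :: "real ^ 'n \<Rightarrow> real" and \<epsilon> :: real
  assume a0: "a \<in> configs0 \<kappa> \<theta>" and \<epsilon>: "0 < \<epsilon>"
  obtain s0 b0 b1 s1 where \<theta>: "\<theta> = (s0, b0, b1, s1)" "0 < s0" "s0 \<le> b0" "b0 < b1" "b1 \<le> s1"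
    using assms(1) by (auto simp: Theta_def)
  let ?P = "{s0, b0, b1, s1}"
  have a: "a \<in> L1" "\<And>x. a x \<in> {0, 1}"
    and mass: "emeasure lborel {x. convolution \<kappa> a x \<in> ?P} = 0"
    using a0 \<theta>(1) by (auto simp: configs0_def configs1_def configs_def)
  obtain C0 where C0: "AE x in lborel. \<bar>\<kappa> x\<bar> \<le> C0"
    using assms(2) by (auto simp: kernels_def)
  \<comment> \<open>The maximum with 1 makes the bound visibly positive, which allows division by
    \<open>C\<close> below.\<close>
  define C where "C = max C0 1"
  have C: "AE x in lborel. \<bar>\<kappa> x\<bar> \<le> C" "0 < C"
    using C0 by (auto simp: C_def elim: eventually_mono)
  have \<kappa>_meas: "\<kappa> \<in> borel_measurable borel"
    using assms(2) by (simp add: kernels_def)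
  have c: "integrable lborel (convolution \<kappa> a)"
    using convolution_integrable[OF assms(2) a(1)] .
  then have [measurable]: "convolution \<kappa> a \<in> borel_measurable borel"
    by (auto dest: borel_measurable_integrable)
  \<comment> \<open>\<open>emeasure\<close> is also 0 on non-measurable sets, so zero mass yields
    this only together with measurability of the convolution.\<close>
  have null: "AE x in lborel. convolution \<kappa> a x \<notin> ?P"
    by (rule AE_I[OF _ mass]) auto
  have pos: "0 < p" if "p \<in> ?P" for p
    using that \<theta> by auto
  have fin: "finite ?P" and half: "0 < \<epsilon> / 2"
    using \<epsilon> by simp_all
  obtain \<eta> where \<eta>: "0 < \<eta>"
    "integrable lborel (\<lambda>x. of_bool (\<exists>p\<in>?P. \<bar>convolution \<kappa> a x - p\<bar> \<le> \<eta>) :: real)"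
    "(\<integral>x. of_bool (\<exists>p\<in>?P. \<bar>convolution \<kappa> a x - p\<bar> \<le> \<eta>) \<partial>lborel) < \<epsilon> / 2"
    using measure_near_positive_levels[OF c fin pos null half] by blast
  show "\<exists>\<delta>>0. \<forall>f\<in>L1. L1_norm (\<lambda>x. f x - a x) < \<delta> \<longrightarrow>
      L1_norm (\<lambda>x. RealLife \<kappa> \<theta> f x - RealLife \<kappa> \<theta> a x) < \<epsilon>"
  proof (intro exI conjI ballI impI)
    \<comment> \<open>The bound \<open>\<eta> / C\<close> keeps the convolutions uniformly within
      \<open>\<eta>\<close>; \<open>\<epsilon> / 2\<close> pays for the term
      \<open>\<bar>f x - a x\<bar>\<close>, and the other half for the near-threshold
      region.\<close>
    show "0 < min (\<epsilon> / 2) (\<eta> / C)"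
      using \<epsilon> \<eta>(1) C(2) by simp
    fix f :: "real ^ 'n \<Rightarrow> real"
    assume f: "f \<in> L1" and small: "L1_norm (\<lambda>x. f x - a x) < min (\<epsilon> / 2) (\<eta> / C)"
    have "C * L1_norm (\<lambda>x. f x - a x) \<le> \<eta>"
      using small C(2) by (simp add: field_simps)
    then have close: "\<bar>convolution \<kappa> f x - convolution \<kappa> a x\<bar> \<le> \<eta>" for x
      using convolution_diff_bound[OF \<kappa>_meas C(1) f a(1), of x] by linarith
    have diff: "integrable lborel (\<lambda>x. \<bar>f x - a x\<bar>)"
      using f a(1) by (simp add: L1_def)
    have "L1_norm (\<lambda>x. RealLife \<kappa> \<theta> f x - RealLife \<kappa> \<theta> a x)
        \<le> (\<integral>x. \<bar>f x - a x\<bar> + of_bool (\<exists>p\<in>?P. \<bar>convolution \<kappa> a x - p\<bar> \<le> \<eta>) \<partial>lborel)"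
      unfolding L1_norm_def
    proof (rule integral_mono)
      show "integrable lborel (\<lambda>x. \<bar>RealLife \<kappa> \<theta> f x - RealLife \<kappa> \<theta> a x\<bar>)"
        using RealLife_in_L1[OF assms(2,1) f] RealLife_in_L1[OF assms(2,1) a(1)]
        by (auto simp: L1_def)
      show "integrable lborel
          (\<lambda>x. \<bar>f x - a x\<bar> + of_bool (\<exists>p\<in>?P. \<bar>convolution \<kappa> a x - p\<bar> \<le> \<eta>))"
        using diff \<eta>(2) by (rule Bochner_Integration.integrable_add)
      show "\<bar>RealLife \<kappa> \<theta> f x - RealLife \<kappa> \<theta> a x\<bar>
          \<le> \<bar>f x - a x\<bar> + of_bool (\<exists>p\<in>?P. \<bar>convolution \<kappa> a x - p\<bar> \<le> \<eta>)" for x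
        unfolding \<theta>(1) by (rule RealLife_diff_bound[OF a(2) close])
    qed
    also have "\<dots> = L1_norm (\<lambda>x. f x - a x)
        + (\<integral>x. of_bool (\<exists>p\<in>?P. \<bar>convolution \<kappa> a x - p\<bar> \<le> \<eta>) \<partial>lborel)"
      unfolding L1_norm_def using diff \<eta>(2) by (rule Bochner_Integration.integral_add)
    also have "\<dots> < \<epsilon> / 2 + \<epsilon> / 2"
      by (rule add_strict_mono[OF _ \<eta>(3)]) (use small in simp)
    also have "\<dots> = \<epsilon>"
      by simp
    finally show "L1_norm (\<lambda>x. RealLife \<kappa> \<theta> f x - RealLife \<kappa> \<theta> a x) < \<epsilon>" .
  qed
qed

end
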